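(* Let $\mathbf a(\theta_0),\mathbf a(\theta_k)\in\mathbb C^N$ be the steering vectors of the beam axis $\theta_0$ and of the controlled angle $\theta_k$, let $\mathbf w_{k-1}\in\mathbb C^N$ be the given previous weight vector and let $\rho_k\in[0,1]$ be the desired level at $\theta_k$. With $\mathbf w_\perp,\mathbf w_\parallel,\mathbf B_k,\mathbf c_{\beta_k},R_{\beta_k}$ and $\mathbb C_{\beta_k}$ as defined in the context, and $\mathbf B_k(2,2)\neq0$, consider the problem $$\max_{\beta_k}\ G_k=\frac{|\mathbf w_k^{H}\mathbf a(\theta_0)|^2}{\|\mathbf w_k\|_2^2}\quad\text{subject to}\quad \mathbf w_k=[\mathbf w_\perp\ \ \mathbf w_\parallel]\,[1\ \ \beta_k]^T,\quad \beta_k\in\mathbb C_{\beta_k}.$$ The optimal solution $\beta_{k,\star}$ of this problem is given by $$\beta_{k,\star}=\beta_{k,l}\triangleq\arg\max_{\beta_k\in\mathbb C_{\beta_k}}|\beta_k|=\bigl(\|\mathbf c_{\beta_k}\|_2+R_{\beta_k}\bigr)e^{j\angle g(\mathbf c_{\beta_k})},$$ where $g(\mathbf c)=\mathbf c(1)+j\,\mathbf c(2)$ for a two-dimensional vector $\mathbf c$.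
   Context: $j=\sqrt{-1}$; $(\cdot)^H$ is conjugate transpose; $\angle z$ is the argument of the complex number $z$. The steering vector of an $N$-element array is $\mathbf a(\theta)=[g_1(\theta)e^{-j\omega\tau_1(\theta)},\dots,g_N(\theta)e^{-j\omega\tau_N(\theta)}]^T$, with $g_n$ the pattern of the $n$th element, $\tau_n$ the time delay between the $n$th element and the reference point, and $\omega$ the operating frequency. Orthogonal decomposition of the previous weight along $\mathbf a(\theta_k)$: $\mathbf w_\parallel=\dfrac{\mathbf a(\theta_k)\mathbf a^H(\theta_k)}{\mathbf a^H(\theta_k)\mathbf a(\theta_k)}\mathbf w_{k-1}$, $\mathbf w_\perp=\mathbf w_{k-1}-\mathbf w_\parallel$. $\mathbf B_k$ is the $2\times2$ Hermitian matrix $$\mathbf B_k=\begin{bmatrix}\mathbf w_\perp^H\mathbf a(\theta_k)\\ \mathbf w_\parallel^H\mathbf a(\theta_k)\end{bmatrix}\begin{bmatrix}\mathbf w_\perp^H\mathbf a(\theta_k)\\ \mathbf w_\parallel^H\mathbf a(\theta_k)\end{bmatrix}^H-\rho_k\begin{bmatrix}\mathbf w_\perp^H\mathbf a(\theta_0)\\ \mathbf w_\parallel^H\mathbf a(\theta_0)\end{bmatrix}\begin{bmatrix}\mathbf w_\perp^H\mathbf a(\theta_0)\\ \mathbf w_\parallel^H\mathbf a(\theta_0)\end{bmatrix}^H .$$ $\mathbf c_{\beta_k}=\dfrac1{\mathbf B_k(2,2)}\begin{bmatrix}-\Re(\mathbf B_k(1,2))\\ \Im(\mathbf B_k(1,2))\end{bmatrix}\in\mathbb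 R^2$, $R_{\beta_k}=\dfrac{\sqrt{-\det\mathbf B_k}}{|\mathbf B_k(2,2)|}$, and $\mathbb C_{\beta_k}=\{\beta_k\in\mathbb C:\ \|[\Re(\beta_k),\Im(\beta_k)]^T-\mathbf c_{\beta_k}\|_2=R_{\beta_k}\}$. This circle is the set of $\beta_k$ for which $\mathbf w_k=\mathbf w_\perp+\beta_k\mathbf w_\parallel$ realizes the response constraint $|\mathbf w_k^H\mathbf a(\theta_k)|^2/|\mathbf w_k^H\mathbf a(\theta_0)|^2=\rho_k$. *)

theory Defs
  imports "HOL-Analysis.Analysis"
begin

text \<open>\<open>hdot x y\<close> is $x^H y$ (conjugate-linear in the first argument); \<open>outer x y\<close> is $x y^H$.\<close>

definition hdot :: "complex^'n \<Rightarrow> complex^'n \<Rightarrow> complex" where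
  "hdot x y = (\<Sum>i\<in>UNIV. cnj (x $ i) * y $ i)"

definition outer :: "complex^'n \<Rightarrow> complex^'m \<Rightarrow> complex^'m^'n" where
  "outer x y = (\<chi> i j. x $ i * cnj (y $ j))"

definition steering_vector ::
    "('n \<Rightarrow> real \<Rightarrow> complex) \<Rightarrow> ('n \<Rightarrow> real \<Rightarrow> real) \<Rightarrow> real \<Rightarrow> real \<Rightarrow> complex^'n" where
  "steering_vector g \<tau> \<omega> \<theta> = (\<chi> n. g n \<theta> * exp (- \<i> * of_real (\<omega> * \<tau> n \<theta>)))"

definition w_par :: "complex^'n \<Rightarrow> complex^'n \<Rightarrow> complex^'n" where
  "w_par a w = (1 / hdot a a) *s (outer a a *v w)"

definition w_perp :: "complex^'n \<Rightarrow> complex^'n \<Rightarrow> complex^'n" where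
  "w_perp a w = w - w_par a w"

definition resp :: "complex^'n \<Rightarrow> complex^'n \<Rightarrow> complex^'n \<Rightarrow> complex^2" where
  "resp wp wl a = vector [hdot wp a, hdot wl a]"

definition B_mat ::
    "complex^'n \<Rightarrow> complex^'n \<Rightarrow> complex^'n \<Rightarrow> real \<Rightarrow> complex^2^2" where
  "B_mat a0 ak w \<rho> =
     (let wp = w_perp ak w; wl = w_par ak w in
        outer (resp wp wl ak) (resp wp wl ak)
        - \<rho> *\<^sub>R outer (resp wp wl a0) (resp wp wl a0))"

text \<open>The matrix is Hermitian, so its diagonal entries and its determinant are real; taking
  \<open>Re\<close> of them below is therefore only a change of type.\<close>

lemma B_mat_hermitian: "cnj (B_mat a0 ak w \<rho> $ i $ j) = B_mat a0 ak w \<rho> $ j $ i"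
  by (simp add: B_mat_def Let_def outer_def mult.commute)

lemma B_mat_diag_real: "B_mat a0 ak w \<rho> $ i $ i \<in> \<real>"
  by (simp add: Reals_cnj_iff B_mat_hermitian)

lemma det_B_mat_real: "det (B_mat a0 ak w \<rho>) \<in> \<real>"
  by (simp add: Reals_cnj_iff det_2 B_mat_hermitian mult.commute)

definition c_beta :: "complex^2^2 \<Rightarrow> real^2" where
  "c_beta B = (1 / Re (B $ 2 $ 2)) *\<^sub>R vector [- Re (B $ 1 $ 2), Im (B $ 1 $ 2)]"

definition R_beta :: "complex^2^2 \<Rightarrow> real" where
  "R_beta B = sqrt (- Re (det B)) / cmod (B $ 2 $ 2)"

definition circle_beta :: "complex^2^2 \<Rightarrow> complex set" where
  "circle_beta B = {\<beta>. norm ((vector [Re \<beta>, Im \<beta>] :: real^2) - c_beta B) = R_beta B}"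

definition vec_to_complex :: "real^2 \<Rightarrow> complex" where
  "vec_to_complex c = of_real (c $ 1) + \<i> * of_real (c $ 2)"

definition w_new :: "complex^'n \<Rightarrow> complex^'n \<Rightarrow> complex \<Rightarrow> complex^'n" where
  "w_new ak w \<beta> = w_perp ak w + \<beta> *s w_par ak w"

definition array_gain ::
    "complex^'n \<Rightarrow> complex^'n \<Rightarrow> complex^'n \<Rightarrow> complex \<Rightarrow> real" where
  "array_gain a0 ak w \<beta> = (cmod (hdot (w_new ak w \<beta>) a0))\<^sup>2 / (norm (w_new ak w \<beta>))\<^sup>2"

end

theory Submission
  imports Defs
begin

text \<open>On the circle the response constraint
  $|\mathbf w_k^H\mathbf a(\theta_k)|^2 = \rho_k\,|\mathbf w_k^H\mathbf a(\theta_0)|^2$ holds. Since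
  $\mathbf w_\perp$ is orthogonal to $\mathbf a(\theta_k)$, its left-hand side is $|\beta|^2$ times a
  constant, and $\|\mathbf w_k\|^2 = \|\mathbf w_\perp\|^2 + |\beta|^2\|\mathbf w_\parallel\|^2$.
  So the gain on the circle is a positive multiple of $x / (p + x l)$ with $x = |\beta|^2$, which is
  strictly increasing for $p = \|\mathbf w_\perp\|^2 > 0$. If $\rho_k = 0$ or $\mathbf w_\perp = 0$,
  the circle degenerates to the point $0$. The farthest point of a circle from the origin lies on
  the ray through its centre.\<close>

section \<open>Sesquilinearity of \<open>hdot\<close>\<close>

lemma hdot_add_left: "hdot (x + y) z = hdot x z + hdot y z"
  by (simp add: hdot_def ring_distribs sum.distrib)

lemma hdot_add_right: "hdot x (y + z) = hdot x y + hdot x z"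
  by (simp add: hdot_def ring_distribs sum.distrib)

lemma hdot_diff_left: "hdot (x - y) z = hdot x z - hdot y z"
  by (simp add: hdot_def ring_distribs sum_subtractf)

lemma hdot_scale_left: "hdot (s *s x) z = cnj s * hdot x z"
  by (simp add: hdot_def sum_distrib_left mult_ac)

lemma hdot_scale_right: "hdot x (s *s z) = s * hdot x z"
  by (simp add: hdot_def sum_distrib_left mult_ac)

lemma hdot_zero_left [simp]: "hdot 0 z = 0"
  by (simp add: hdot_def)

lemma hdot_zero_right [simp]: "hdot x 0 = 0"
  by (simp add: hdot_def)

lemma cnj_hdot: "cnj (hdot x y) = hdot y x"
  by (simp add: hdot_def mult.commute)

lemma hdot_self: "hdot x x = of_real ((norm x)\<^sup>2)"
proof -
  have "(norm x)\<^sup>2 = (\<Sum>i\<in>UNIV. (cmod (x $ i))\<^sup>2)"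
    by (simp add: norm_vec_def L2_set_def sum_nonneg)
  then show ?thesis
    by (simp add: hdot_def mult.commute complex_norm_square del: of_real_power)
qed

section \<open>The orthogonal decomposition along \<open>a\<close>\<close>

lemma w_par_eq: "w_par a w = (hdot a w / hdot a a) *s a"
proof -
  have "outer a a *v w = hdot a w *s a"
    by (simp add: outer_def hdot_def matrix_vector_mult_def vec_eq_iff sum_distrib_left mult_ac)
  then show ?thesis
    by (simp add: w_par_def vector_smult_assoc)
qed

lemma hdot_w_perp: "hdot (w_perp a w) a = 0"
\<comment> \<open>For \<open>a = 0\<close> the coefficient in \<open>w_par_eq\<close> divides by
  zero, but then every product with \<open>a\<close> vanishes anyway.\<close>
proof (cases "a = 0")
  case False
  then have "hdot a a \<noteq> 0"
    by (simp add: hdot_self)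
  then show ?thesis
    by (simp add: w_perp_def w_par_eq hdot_diff_left hdot_scale_left cnj_hdot)
qed simp

text \<open>\<open>w_par a w\<close> is a multiple \<open>s *s a\<close>, and its product with
  \<open>a\<close> is \<open>cnj s\<close> times the squared norm of \<open>a\<close>; so
  \<open>s\<close> or \<open>a\<close> is zero. This later turns \<open>B $ 2 $ 2 \<noteq> 0\<close>
  into positivity of \<open>Q\<close>.\<close>

lemma w_par_eq_0_if: "hdot (w_par a w) a = 0 \<Longrightarrow> w_par a w = 0"
  by (auto simp: w_par_eq hdot_scale_left hdot_self)

text \<open>Pythagoras: \<open>w_par\<close> is a multiple of \<open>a\<close>, to which
  \<open>w_perp\<close> is orthogonal, so the cross terms vanish.\<close>

lemma norm_w_new:
  "(norm (w_new a w \<beta>))\<^sup>2 = (norm (w_perp a w))\<^sup>2 + (cmod \<beta>)\<^sup>2 * (norm (w_par a w))\<^sup>2"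
proof -
  have 1: "hdot (w_perp a w) (w_par a w) = 0"
    by (simp add: w_par_eq[of a w] hdot_scale_right hdot_w_perp)
  then have 2: "hdot (w_par a w) (w_perp a w) = 0"
    by (metis cnj_hdot complex_cnj_zero)
  have "complex_of_real ((norm (w_new a w \<beta>))\<^sup>2) = of_real ((norm (w_perp a w))\<^sup>2)
      + (cnj \<beta> * \<beta>) * of_real ((norm (w_par a w))\<^sup>2)"
    unfolding hdot_self[symmetric] w_new_def
    by (simp add: hdot_add_left hdot_add_right hdot_scale_left hdot_scale_right 1 2)
  also have "cnj \<beta> * \<beta> = of_real ((cmod \<beta>)\<^sup>2)"
    by (simp add: complex_norm_square mult.commute del: of_real_power)
  finally show ?thesis
    by (simp only: of_real_add[symmetric] of_real_mult[symmetric] of_real_eq_iff)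
qed

section \<open>Circles in the complex plane and their farthest point from the origin\<close>

lemma cmod_vec_to_complex: "cmod (vec_to_complex c) = norm c"
  by (simp add: vec_to_complex_def norm_vec_def L2_set_def sum_2 cmod_def)

lemma circle_beta_eq: "circle_beta B = sphere (vec_to_complex (c_beta B)) (R_beta B)"
proof -
  have "cmod (\<beta> - vec_to_complex c) = norm ((vector [Re \<beta>, Im \<beta>] :: real^2) - c)" for \<beta> c
    by (simp add: vec_to_complex_def norm_vec_def L2_set_def sum_2 cmod_def vector_2)
  then show ?thesis
    by (auto simp: circle_beta_def sphere_def dist_norm norm_minus_commute)
qed

text \<open>The bound is the triangle inequality for \<open>y = z + (y - z)\<close>; equality forces
  \<open>y - z\<close> to point along \<open>z\<close>. If \<open>z = 0\<close> and
  \<open>r > 0\<close>, all points of the circle tie, hence the side condition on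
  uniqueness.\<close>

lemma farthest_point_sphere:
  fixes z :: complex
  assumes "0 \<le> r"
  defines "b \<equiv> of_real (cmod z + r) * exp (\<i> * of_real (Arg z))"
  shows "b \<in> sphere z r" and "cmod b = cmod z + r"
    and "\<And>y. y \<in> sphere z r \<Longrightarrow> cmod y \<le> cmod b"
    and "\<And>y. \<lbrakk>y \<in> sphere z r; cmod y = cmod b; z \<noteq> 0 \<or> r = 0\<rbrakk> \<Longrightarrow> y = b"
proof -
  define e where "e = exp (\<i> * of_real (Arg z))"
  have e1: "cmod e = 1"
    by (simp add: e_def norm_exp_i_times)
  have z: "z = of_real (cmod z) * e"
    using rcis_cmod_Arg[of z] by (simp add: e_def rcis_def cis_conv_exp)
  have b: "b = z + of_real r * e"
    unfolding b_def e_def[symmetric] by (subst (2) z) (simp add: ring_distribs)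
  show "b \<in> sphere z r"
    using e1 assms(1) by (simp add: b dist_norm norm_mult)
  show nb: "cmod b = cmod z + r"
    unfolding b_def e_def[symmetric] norm_mult e1 norm_of_real using assms(1) by simp
  fix y assume y: "y \<in> sphere z r"
  then have r: "cmod (y - z) = r"
    by (simp add: dist_norm norm_minus_commute)
  show "cmod y \<le> cmod b"
    using norm_triangle_ineq[of z "y - z"] r nb by simp
  assume eq: "cmod y = cmod b" and "z \<noteq> 0 \<or> r = 0"
  then consider "r = 0" | "z \<noteq> 0" by blast
  then show "y = b"
  proof cases
    case 1
    then show ?thesis using r b by simp
  next
    case 2
    have "cmod (z + (y - z)) = cmod z + cmod (y - z)"
      using eq nb r by simp
    \<comment> \<open>\<open>norm_triangle_eq\<close> characterizes equality by
      \<open>norm x *\<^sub>R y = norm y *\<^sub>R x\<close>, here with \<open>x = z\<close> and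
      \<open>y - z\<close> for \<open>y\<close>.\<close>
    then have "of_real (cmod z) * (y - z) = of_real r * z"
      unfolding norm_triangle_eq by (simp add: r scaleR_conv_of_real)
    also have "\<dots> = of_real (cmod z) * (of_real r * e)"
      by (subst z) simp
    finally have "y - z = of_real r * e"
      using 2 by simp
    then show ?thesis
      by (simp add: b algebra_simps)
  qed
qed

text \<open>The response constraint in scalar form: \<open>D\<close> stands for
  \<open>B $ 2 $ 2\<close>, \<open>u\<close> and \<open>v\<close> for the products of
  \<open>w_perp\<close> and \<open>w_par\<close> with \<open>a0\<close>, and \<open>Q\<close> for
  the squared modulus of the product of \<open>w_par\<close> with \<open>ak\<close>. Expanding the
  circle equation leaves a common factor \<open>D\<close> to cancel.\<close>

lemma mem_sphere_imp_response:
  fixes u v \<beta> :: complex and D Q \<rho> :: real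
  assumes D: "D = Q - \<rho> * (cmod v)\<^sup>2" "D \<noteq> 0" and "0 \<le> Q" "0 \<le> \<rho>"
    and mem: "\<beta> \<in> sphere (of_real (\<rho> / D) * (cnj u * v)) (sqrt (\<rho> * (cmod u)\<^sup>2 * Q) / \<bar>D\<bar>)"
  shows "(cmod \<beta>)\<^sup>2 * Q = \<rho> * (cmod (u + cnj \<beta> * v))\<^sup>2"
proof -
  let ?k = "of_real \<rho> * (cnj u * v)"
  \<comment> \<open>Scaling by \<open>D\<close> clears the denominators of both centre and
    radius.\<close>
  have eq: "of_real D * \<beta> - ?k = of_real D * (\<beta> - of_real (\<rho> / D) * (cnj u * v))"
    using D(2) by (simp add: field_simps)
  have "cmod (of_real D * \<beta> - ?k) = sqrt (\<rho> * (cmod u)\<^sup>2 * Q)"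
    unfolding eq norm_mult using mem D(2) by (simp add: dist_norm norm_minus_commute)
  then have "(cmod (of_real D * \<beta> - ?k))\<^sup>2 = \<rho> * (cmod u)\<^sup>2 * Q"
    using assms(3,4) by simp
  also have "(cmod (of_real D * \<beta> - ?k))\<^sup>2
      = D\<^sup>2 * (cmod \<beta>)\<^sup>2 - 2 * D * \<rho> * Re (cnj \<beta> * cnj u * v) + \<rho>\<^sup>2 * ((cmod u)\<^sup>2 * (cmod v)\<^sup>2)"
    unfolding cmod_power2 by (simp add: power2_eq_square) algebra
  \<comment> \<open>Since \<open>\<rho> * (cmod v)\<^sup>2 = Q - D\<close>, the constant terms on
    the two sides differ by \<open>D * \<rho> * (cmod u)\<^sup>2\<close>.\<close>
  finally have "D * (D * (cmod \<beta>)\<^sup>2 - 2 * \<rho> * Re (cnj \<beta> * cnj u * v)) = D * (\<rho> * (cmod u)\<^sup>2)"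
    using D(1) by algebra
  then have "D * (cmod \<beta>)\<^sup>2 - 2 * \<rho> * Re (cnj \<beta> * cnj u * v) = \<rho> * (cmod u)\<^sup>2"
    using D(2) by simp
  moreover have "(cmod (u + cnj \<beta> * v))\<^sup>2
      = (cmod u)\<^sup>2 + (cmod \<beta>)\<^sup>2 * (cmod v)\<^sup>2 + 2 * Re (cnj \<beta> * cnj u * v)"
    unfolding cmod_power2 by (simp add: power2_eq_square) algebra
  ultimately show ?thesis
    using D(1) by algebra
qed

text \<open>After cross-multiplication the terms \<open>x * y * l\<close> cancel.\<close>

lemma ratio_less_iff:
  fixes p l x y :: real
  assumes "0 < p" "0 \<le> l" "0 \<le> x" "0 \<le> y"
  shows "x / (p + x * l) < y / (p + y * l) \<longleftrightarrow> x < y"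
proof -
  have "0 < p + x * l" "0 < p + y * l"
    using assms by (simp_all add: add_pos_nonneg)
  then have "x / (p + x * l) < y / (p + y * l) \<longleftrightarrow> p * x < p * y"
    by (simp add: divide_simps algebra_simps)
  then show ?thesis
    using assms(1) by simp
qed

section \<open>The matrix \<open>B\<close> and its circle in terms of \<open>u\<close>,
  \<open>v\<close> and \<open>Q\<close>\<close>

context
  fixes a0 ak w :: "complex^'n::finite" and \<rho> Q :: real and u v :: complex and B :: "complex^2^2"
  defines "B \<equiv> B_mat a0 ak w \<rho>"
    and "Q \<equiv> (cmod (hdot (w_par ak w) ak))\<^sup>2"
    and "u \<equiv> hdot (w_perp ak w) a0" and "v \<equiv> hdot (w_par ak w) a0"
begin

lemma B_mat_entry:
  "B $ i $ j = resp (w_perp ak w) (w_par ak w) ak $ i * cnj (resp (w_perp ak w) (w_par ak w) ak $ j)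
    - of_real \<rho> * (resp (w_perp ak w) (w_par ak w) a0 $ i
        * cnj (resp (w_perp ak w) (w_par ak w) a0 $ j))"
  unfolding B_def B_mat_def Let_def
  by (simp add: outer_def scaleR_conv_of_real[where 'a = complex])

lemma B_mat_22: "B $ 2 $ 2 = of_real (Q - \<rho> * (cmod v)\<^sup>2)"
  by (simp add: B_mat_entry Q_def v_def resp_def vector_2 complex_norm_square del: of_real_power)

lemma B_mat_12: "B $ 1 $ 2 = - of_real \<rho> * (u * cnj v)"
  by (simp add: B_mat_entry u_def v_def resp_def vector_2 hdot_w_perp)

text \<open>The first response at \<open>ak\<close> is zero by orthogonality, and the terms with
  both \<open>u\<close> and \<open>v\<close> cancel. Hence the radicand in \<open>R_beta B\<close>
  is nonnegative for \<open>\<rho> \<ge> 0\<close>.\<close>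

lemma det_B_mat: "det B = - of_real (\<rho> * (cmod u)\<^sup>2 * Q)"
  by (simp add: det_2 B_mat_entry Q_def u_def resp_def vector_2 hdot_w_perp complex_norm_square
      algebra_simps del: of_real_power)

text \<open>The signs in \<open>c_beta\<close> make the centre
  \<open>- cnj (B $ 1 $ 2) / B $ 2 $ 2\<close>, which explains the conjugate on
  \<open>u\<close>.\<close>

lemma circle_beta_B_mat:
  "circle_beta B = sphere (of_real (\<rho> / (Q - \<rho> * (cmod v)\<^sup>2)) * (cnj u * v))
    (sqrt (\<rho> * (cmod u)\<^sup>2 * Q) / \<bar>Q - \<rho> * (cmod v)\<^sup>2\<bar>)"
proof -
  have "vec_to_complex (c_beta B) = of_real (\<rho> / (Q - \<rho> * (cmod v)\<^sup>2)) * (cnj u * v)"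
    by (simp add: vec_to_complex_def c_beta_def B_mat_22 B_mat_12 vector_2 complex_eq_iff
        field_simps)
  moreover have "R_beta B = sqrt (\<rho> * (cmod u)\<^sup>2 * Q) / \<bar>Q - \<rho> * (cmod v)\<^sup>2\<bar>"
    unfolding R_beta_def det_B_mat B_mat_22 norm_of_real by simp
  ultimately show ?thesis
    by (simp only: circle_beta_eq)
qed

lemma R_beta_B_mat_nonneg: "0 \<le> \<rho> \<Longrightarrow> 0 \<le> R_beta B"
  unfolding R_beta_def det_B_mat by (simp add: Q_def)

text \<open>Gain and modulus induce the same strict order on the circle, so the two maximization
  problems have the same solutions.\<close>

lemma array_gain_less_iff:
  assumes \<rho>: "0 \<le> \<rho>" and B22: "B $ 2 $ 2 \<noteq> 0"
    and mem: "\<beta> \<in> circle_beta B" "\<beta>' \<in> circle_beta B"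
  shows "array_gain a0 ak w \<beta> < array_gain a0 ak w \<beta>' \<longleftrightarrow> cmod \<beta> < cmod \<beta>'"
proof (cases "\<rho> = 0 \<or> w_perp ak w = 0")
  case True
  then have "\<rho> = 0 \<or> u = 0"
    by (auto simp: u_def)
  \<comment> \<open>Centre and radius both vanish when \<open>\<rho>\<close> or \<open>u\<close>
    does.\<close>
  then have "circle_beta B = {0}"
    unfolding circle_beta_B_mat by auto
  then show ?thesis
    using mem by simp
next
  case False
  let ?p = "(norm (w_perp ak w))\<^sup>2" and ?l = "(norm (w_par ak w))\<^sup>2"
  have D: "Q - \<rho> * (cmod v)\<^sup>2 \<noteq> 0"
    using B22 unfolding B_mat_22 of_real_eq_0_iff .
  \<comment> \<open>Otherwise \<open>w_par\<close> would be zero, and with it both terms of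
    \<open>B $ 2 $ 2\<close>.\<close>
  have "hdot (w_par ak w) ak \<noteq> 0"
  proof
    assume 0: "hdot (w_par ak w) ak = 0"
    from w_par_eq_0_if[OF this] have "v = 0"
      by (simp add: v_def)
    with 0 D show False
      by (simp add: Q_def)
  qed
  then have Q: "0 < Q"
    by (simp add: Q_def)
  have \<rho>0: "0 < \<rho>"
    using False \<rho> by simp
  \<comment> \<open>The response constraint rewrites the numerator, Pythagoras the
    denominator.\<close>
  have gain: "array_gain a0 ak w b = Q / \<rho> * ((cmod b)\<^sup>2 / (?p + (cmod b)\<^sup>2 * ?l))"
    if "b \<in> circle_beta B" for b
  proof -
    have "(cmod b)\<^sup>2 * Q = \<rho> * (cmod (u + cnj b * v))\<^sup>2"
      using mem_sphere_imp_response[OF refl D _ \<rho> that[unfolded circle_beta_B_mat]] Q by simp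
    then have "(cmod (u + cnj b * v))\<^sup>2 = Q / \<rho> * (cmod b)\<^sup>2"
      using \<rho>0 by (simp add: field_simps)
    moreover have "hdot (w_new ak w b) a0 = u + cnj b * v"
      by (simp add: w_new_def u_def v_def hdot_add_left hdot_scale_left)
    ultimately show ?thesis
      by (simp add: array_gain_def norm_w_new)
  qed
  have "array_gain a0 ak w \<beta> < array_gain a0 ak w \<beta>' \<longleftrightarrow>
      (cmod \<beta>)\<^sup>2 / (?p + (cmod \<beta>)\<^sup>2 * ?l) < (cmod \<beta>')\<^sup>2 / (?p + (cmod \<beta>')\<^sup>2 * ?l)"
    unfolding gain[OF mem(1)] gain[OF mem(2)] using Q \<rho>0
    by (intro mult_less_cancel_left_pos) simp
  also have "\<dots> \<longleftrightarrow> (cmod \<beta>)\<^sup>2 < (cmod \<beta>')\<^sup>2"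
    using False by (intro ratio_less_iff) simp_all
  finally show ?thesis
    by (simp add: power_mono_iff flip: not_le)
qed

end

text \<open>If \<open>c = 0\<close> and \<open>R > 0\<close>, all points of the circle have equal
  modulus and hence equal gain, so every one is optimal; the last conjunct therefore claims
  uniqueness in the remaining cases.\<close>

theorem proposition2:
  fixes g :: "'n::finite \<Rightarrow> real \<Rightarrow> complex"
    and \<tau> :: "'n \<Rightarrow> real \<Rightarrow> real"
    and \<omega> \<theta>0 \<theta>k \<rho> R :: real
    and a0 ak w :: "complex^'n"
    and B :: "complex^2^2"
    and c :: "real^2"
    and C :: "complex set"
    and \<beta>l :: complex
  assumes "a0 = steering_vector g \<tau> \<omega> \<theta>0"
    and "ak = steering_vector g \<tau> \<omega> \<theta>k"
    and "0 \<le> \<rho>" and "\<rho> \<le> 1"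
    and "B = B_mat a0 ak w \<rho>"
    and "B $ 2 $ 2 \<noteq> 0"
    and "c = c_beta B" and "R = R_beta B" and "C = circle_beta B"
    and "\<beta>l = of_real (norm c + R) * exp (\<i> * of_real (Arg (vec_to_complex c)))"
  shows "is_arg_max (array_gain a0 ak w) (\<lambda>\<beta>. \<beta> \<in> C) \<beta>l
    \<and> is_arg_max cmod (\<lambda>\<beta>. \<beta> \<in> C) \<beta>l
    \<and> {\<beta>. is_arg_max (array_gain a0 ak w) (\<lambda>\<beta>. \<beta> \<in> C) \<beta>}
        = {\<beta>. is_arg_max cmod (\<lambda>\<beta>. \<beta> \<in> C) \<beta>}
    \<and> (c \<noteq> 0 \<or> R = 0 \<longrightarrow>
        {\<beta>. is_arg_max (array_gain a0 ak w) (\<lambda>\<beta>. \<beta> \<in> C) \<beta>} = {\<beta>l})"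
proof -
  have R: "0 \<le> R"
    using R_beta_B_mat_nonneg[OF assms(3)] assms(5,8) by simp
  have C: "C = sphere (vec_to_complex c) R"
    using assms(7-9) by (simp add: circle_beta_eq)
  have \<beta>l: "\<beta>l = of_real (cmod (vec_to_complex c) + R) * exp (\<i> * of_real (Arg (vec_to_complex c)))"
    using assms(10) by (simp add: cmod_vec_to_complex)
  note far = farthest_point_sphere[OF R, where z = "vec_to_complex c", folded \<beta>l C]
  have less: "array_gain a0 ak w \<beta> < array_gain a0 ak w \<beta>' \<longleftrightarrow> cmod \<beta> < cmod \<beta>'"
    if "\<beta> \<in> C" "\<beta>' \<in> C" for \<beta> \<beta>'
    using array_gain_less_iff[of \<rho> a0 ak w] assms(3,5,6,9) that by simp
  \<comment> \<open>\<open>is_arg_max\<close> depends on the objective only through its strict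
    comparisons on \<open>C\<close>.\<close>
  then have same: "is_arg_max (array_gain a0 ak w) (\<lambda>\<beta>. \<beta> \<in> C) = is_arg_max cmod (\<lambda>\<beta>. \<beta> \<in> C)"
    unfolding is_arg_max_def fun_eq_iff by blast
  have max: "is_arg_max cmod (\<lambda>\<beta>. \<beta> \<in> C) \<beta>l"
    unfolding is_arg_max_def using far(1,3) by (meson not_less)
  have uniq: "\<beta> = \<beta>l" if "c \<noteq> 0 \<or> R = 0" "is_arg_max cmod (\<lambda>\<beta>. \<beta> \<in> C) \<beta>" for \<beta>
  proof (rule far(4))
    show "\<beta> \<in> C"
      using that(2) by (simp add: is_arg_max_def)
    show "cmod \<beta> = cmod \<beta>l"
      using that(2) max unfolding is_arg_max_def by (metis linorder_less_linear)
    show "vec_to_complex c \<noteq> 0 \<or> R = 0"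
      using that(1) cmod_vec_to_complex[of c] by auto
  qed
  show ?thesis
    unfolding same using max uniq by blast
qed

end
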